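(* Let $X$ be a real Banach space and let $A:X\rightarrow X^*$ be linear, continuous and ultramaximally monotone. Suppose that there exists $\delta>0$ such that $\langle Ax, x\rangle\geq\delta\|x\|^2$ for all $x\in X$. Then $X$ is reflexive.
   Context: $X$ is a real Banach space with dual $X^*$ and bidual $X^{**}$; $X$ is identified with its canonical image in $X^{**}$, and $\langle\cdot,\cdot\rangle$ denotes the duality pairing. A linear operator $A:X\to X^*$ is regarded as a set-valued operator with graph $\operatorname{gra}A=\{(x,Ax)\mid x\in X\}$. $A$ is monotone if $\langle x-y,x^*-y^*\rangle\ge 0$ for all $(x,x^* ),(y,y^* )\in\operatorname{gra}A$. A monotone $A$ is ultramaximally monotone if it is maximally monotone with respect to $X^{**}\times X^*$: whenever $(x^{**},x^* )\in X^{**}\times X^*$ satisfies $\langle x^{**}-a,x^*-a^*\rangle\ge 0$ for all $(a,a^* )\in\operatorname{gra}A$, then $x^{**}\in X$ and $(x^{**},x^* )\in\operatorname{gra}A$. *)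

theory Defs
  imports "HOL-Analysis.Analysis"
begin

type_synonym 'a dual = "'a \<Rightarrow>\<^sub>L real"
type_synonym 'a bidual = "'a dual dual"

definition bidual_embed :: "'a::real_normed_vector \<Rightarrow> 'a bidual" where
  "bidual_embed x = Blinfun (\<lambda>f. blinfun_apply f x)"

lemma bidual_embed_apply [simp]:
  "blinfun_apply (bidual_embed x) f = blinfun_apply f x"
  unfolding bidual_embed_def
  by (simp add: bounded_linear_Blinfun_apply blinfun.bounded_linear_left)

definition gra :: "('a \<Rightarrow> 'b) \<Rightarrow> ('a \<times> 'b) set" where
  "gra A = {(x, A x) | x. True}"

definition monotone_operator :: "('a::real_normed_vector \<times> 'a dual) set \<Rightarrow> bool" where
  "monotone_operator G \<longleftrightarrow>
     (\<forall>(x, xs)\<in>G. \<forall>(y, ys)\<in>G. 0 \<le> blinfun_apply (xs - ys) (x - y))"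

(* Elements of X are compared with elements of the bidual through bidual_embed,
   so "xss belongs to X and (xss, xs) to the graph" reads: xss = bidual_embed x with (x, xs) in G. *)
definition ultramaximally_monotone :: "('a::real_normed_vector \<times> 'a dual) set \<Rightarrow> bool" where
  "ultramaximally_monotone G \<longleftrightarrow>
     monotone_operator G \<and>
     (\<forall>(xss :: 'a bidual) (xs :: 'a dual).
        (\<forall>(a, as)\<in>G. 0 \<le> blinfun_apply (xss - bidual_embed a) (xs - as))
        \<longrightarrow> (\<exists>x. xss = bidual_embed x \<and> (x, xs) \<in> G))"

definition reflexive_space :: "'a::real_normed_vector itself \<Rightarrow> bool" where
  "reflexive_space _ \<longleftrightarrow> surj (bidual_embed :: 'a \<Rightarrow> 'a bidual)"

end

theory Submission
  imports Defs
begin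

text \<open>The symmetric part of a continuous coercive operator is an inner product whose norm is
  equivalent to the given one, so the space is isomorphic to a Hilbert space. By the Riesz
  representation theorem for this inner product, every functional on the dual is an evaluation.\<close>

lemma bounded_linear_if_linear_continuous:
  fixes f :: "'a::real_normed_vector \<Rightarrow> 'b::real_normed_vector"
  assumes "linear f" and "continuous_on UNIV f"
  shows "bounded_linear f"
proof -
  interpret linear f by fact
  have "isCont f 0"
    using assms(2) by (simp add: continuous_on_eq_continuous_at)
  then obtain d where "d > 0" and d: "\<And>x. norm x < d \<Longrightarrow> norm (f x) < 1"
    unfolding continuous_at_eps_delta by (auto simp: dist_norm zero dest: spec[of _ 1])
  show ?thesis
  proof (intro bounded_linear_intro[where K = "2 / d"])
    fix x
    show "norm (f x) \<le> norm x * (2 / d)"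
    proof (cases "x = 0")
      case False
      \<comment> \<open>Rescaling \<open>x\<close> to norm \<open>d / 2\<close> brings it into the
        ball where \<open>f\<close> stays below 1; homogeneity carries the bound back.\<close>
      define c where "c = d / (2 * norm x)"
      have "c > 0" using False \<open>d > 0\<close> by (simp add: c_def)
      have "norm (c *\<^sub>R x) < d" using False \<open>d > 0\<close> by (simp add: c_def)
      from d[OF this] have "c * norm (f x) < 1" using \<open>c > 0\<close> by (simp add: scale)
      then show ?thesis using False \<open>d > 0\<close> by (simp add: c_def field_simps)
    qed (simp add: zero)
  qed (simp_all add: add scale)
qed

lemma bounded_bilinear_add:
  assumes "bounded_bilinear f" and "bounded_bilinear g"
  shows "bounded_bilinear (\<lambda>x y. f x y + g x y)"
proof -
  interpret f: bounded_bilinear f by fact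
  interpret g: bounded_bilinear g by fact
  obtain K L where "\<And>x y. norm (f x y) \<le> norm x * norm y * K"
    and "\<And>x y. norm (g x y) \<le> norm x * norm y * L"
    using f.bounded g.bounded by blast
  then have "norm (f x y + g x y) \<le> norm x * norm y * (K + L)" for x y
    by (metis distrib_left norm_add_rule_thm)
  then have "\<exists>M. \<forall>x y. norm (f x y + g x y) \<le> norm x * norm y * M" by blast
  then show ?thesis
    by (intro bounded_bilinear.intro)
      (simp_all add: f.add_left f.add_right g.add_left g.add_right
        f.scaleR_left f.scaleR_right g.scaleR_left g.scaleR_right scaleR_right_distrib)
qed

text \<open>Direct method for the quadratic energy whose stationary points represent
  \<open>f\<close> through \<open>B\<close>. Coercivity bounds the energy below and, by the
  parallelogram identity, makes a minimizing sequence Cauchy; completeness supplies its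
  limit.\<close>

lemma coercive_form_minimizer:
  fixes B :: "'a::banach \<Rightarrow> 'a \<Rightarrow> real" and f :: "'a dual"
  assumes "bounded_bilinear B" and sym: "\<And>x y. B x y = B y x"
    and "\<delta> > 0" and coercive: "\<And>x. B x x \<ge> \<delta> * (norm x)\<^sup>2"
  obtains x where "\<And>y. B x x - 2 * f x \<le> B y y - 2 * f y"
proof -
  interpret B: bounded_bilinear B by fact
  define q where "q = (\<lambda>x. B x x - 2 * f x)"
  have lower: "- (norm f)\<^sup>2 / \<delta> \<le> q x" for x
  proof -
    have "f x \<le> norm f * norm x"
      using norm_blinfun[of f x] by simp
    \<comment> \<open>Completing the square in \<open>norm x\<close> yields a lower bound
      independent of \<open>x\<close>.\<close>
    moreover have "0 \<le> (\<delta> * norm x - norm f)\<^sup>2 / \<delta>" using \<open>\<delta> > 0\<close> by simp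
    then have "0 \<le> \<delta> * (norm x)\<^sup>2 - 2 * (norm f * norm x) + (norm f)\<^sup>2 / \<delta>"
      using \<open>\<delta> > 0\<close> by (simp add: field_simps power2_eq_square)
    ultimately show ?thesis using coercive[of x] unfolding q_def by simp
  qed
  then have bdd: "bdd_below (range q)" by (intro bdd_belowI2)
  define m where "m = Inf (range q)"
  have m: "m \<le> q x" for x unfolding m_def using bdd by (simp add: cInf_lower)
  have "\<exists>x. q x < m + inverse (Suc n)" for n
  proof -
    have "Inf (range q) < m + inverse (Suc n)" unfolding m_def by simp
    then show ?thesis using bdd by (subst (asm) cInf_less_iff) auto
  qed
  then obtain u where u: "\<And>n. q (u n) < m + inverse (Suc n)" by metis
  \<comment> \<open>The linear term \<open>f\<close> cancels at the midpoint, so only the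
    parallelogram law of \<open>B\<close> remains.\<close>
  have parallelogram: "q a + q b = 2 * q ((1/2) *\<^sub>R (a + b)) + B (a - b) (a - b) / 2" for a b
    unfolding q_def
    by (simp add: B.add_left B.add_right B.diff_left B.diff_right B.scaleR_left B.scaleR_right
        blinfun.add_right blinfun.scaleR_right sym[of b a] field_simps)
  \<comment> \<open>The midpoint also has energy at least \<open>m\<close>, so two nearly minimal
    points must lie close together.\<close>
  have close: "\<delta> * (norm (a - b))\<^sup>2 \<le> 2 * ((q a - m) + (q b - m))" for a b
    using parallelogram[of a b] m[of "(1/2) *\<^sub>R (a + b)"] coercive[of "a - b"] by simp
  have "Cauchy u"
  proof (rule metric_CauchyI)
    fix e :: real assume "e > 0"
    \<comment> \<open>The divisor 4 absorbs the factor 2 in \<open>close\<close> and its two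
      excesses over \<open>m\<close>.\<close>
    then have "\<delta> * e\<^sup>2 / 4 > 0" using \<open>\<delta> > 0\<close> by simp
    then obtain N where N: "inverse (Suc N) < \<delta> * e\<^sup>2 / 4"
      using reals_Archimedean by blast
    have near: "q (u n) - m < \<delta> * e\<^sup>2 / 4" if "n \<ge> N" for n
    proof -
      have "inverse (real (Suc n)) \<le> inverse (real (Suc N))" using that by (simp add: le_imp_inverse_le)
      then show ?thesis using u[of n] N by linarith
    qed
    have "dist (u i) (u j) < e" if "i \<ge> N" "j \<ge> N" for i j
    proof -
      have "\<delta> * (norm (u i - u j))\<^sup>2 < \<delta> * e\<^sup>2"
        using close[of "u i" "u j"] near[OF that(1)] near[OF that(2)] by simp
      then have "(norm (u i - u j))\<^sup>2 < e\<^sup>2" using \<open>\<delta> > 0\<close> by simp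
      then show ?thesis using \<open>e > 0\<close> by (simp add: dist_norm power_less_imp_less_base)
    qed
    then show "\<exists>N. \<forall>i\<ge>N. \<forall>j\<ge>N. dist (u i) (u j) < e" by blast
  qed
  then obtain x where x: "u \<longlonglongrightarrow> x" using Cauchy_convergent convergent_def by blast
  have "(\<lambda>n. q (u n)) \<longlonglongrightarrow> q x"
    unfolding q_def by (intro tendsto_intros B.tendsto x)
  moreover have "(\<lambda>n. m + inverse (Suc n)) \<longlonglongrightarrow> m + 0"
    by (intro tendsto_intros LIMSEQ_inverse_real_of_nat)
  moreover have "\<forall>n\<ge>0. q (u n) \<le> m + inverse (Suc n)"
    using u less_imp_le by blast
  ultimately have "q x \<le> m + 0"
    by (blast intro: LIMSEQ_le)
  then have "q x \<le> q y" for y using m[of y] by simp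
  then show ?thesis using that unfolding q_def by blast
qed

text \<open>Riesz representation for the inner product \<open>B\<close>: at a minimizer of the
  energy the derivative in every direction \<open>y\<close>, which is
  \<open>2 * (B x y - f y)\<close>, must vanish.\<close>

lemma coercive_form_riesz:
  fixes B :: "'a::banach \<Rightarrow> 'a \<Rightarrow> real" and f :: "'a dual"
  assumes "bounded_bilinear B" and sym: "\<And>x y. B x y = B y x"
    and "\<delta> > 0" and coercive: "\<And>x. B x x \<ge> \<delta> * (norm x)\<^sup>2"
  obtains x where "\<And>y. f y = B x y"
proof -
  interpret B: bounded_bilinear B by fact
  obtain x where x: "\<And>y. B x x - 2 * f x \<le> B y y - 2 * f y"
    using coercive_form_minimizer[OF assms] by blast
  have "f y = B x y" for y
  proof (cases "y = 0")
    case True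
    then show ?thesis by (simp add: blinfun.zero_right B.zero_right)
  next
    case False
    then have pos: "B y y > 0"
      using coercive[of y] \<open>\<delta> > 0\<close> by (smt (verit) mult_pos_pos zero_less_norm_iff zero_less_power)
    define c where "c = B x y - f y"
    \<comment> \<open>Moving from \<open>x\<close> by \<open>t *\<^sub>R y\<close> changes the
      energy by \<open>2 * t * c + t * t * B y y\<close>. This \<open>t\<close> minimizes that
      quadratic, and the resulting value is negative unless \<open>c = 0\<close>.\<close>
    define t where "t = - c / B y y"
    have "0 \<le> 2 * t * c + t * t * B y y"
      using x[of "x + t *\<^sub>R y"] unfolding c_def
      by (simp add: B.add_left B.add_right B.scaleR_left B.scaleR_right blinfun.add_right
          blinfun.scaleR_right sym[of y x] algebra_simps)
    also have "\<dots> = - c\<^sup>2 / B y y"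
      using pos unfolding t_def by (simp add: field_simps power2_eq_square)
    finally have "c\<^sup>2 \<le> 0" using pos by (simp add: field_simps)
    then show ?thesis by (simp add: c_def)
  qed
  then show ?thesis using that by blast
qed

text \<open>Riesz is used twice: once to represent the pullback of a bidual element along the map
  \<open>S\<close> from the space to its dual, and once to write an arbitrary functional as a value
  of \<open>S\<close>.\<close>

lemma coercive_form_imp_reflexive:
  fixes B :: "'a::banach \<Rightarrow> 'a \<Rightarrow> real"
  assumes "bounded_bilinear B" and sym: "\<And>x y. B x y = B y x"
    and "\<delta> > 0" and "\<And>x. B x x \<ge> \<delta> * (norm x)\<^sup>2"
  shows "reflexive_space TYPE('a)"
  unfolding reflexive_space_def surj_def
proof
  interpret B: bounded_bilinear B by fact
  note riesz = coercive_form_riesz[OF assms]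
  define S where "S = (\<lambda>x. Blinfun (B x))"
  have S: "S x y = B x y" for x y
    unfolding S_def by (simp add: bounded_linear_Blinfun_apply B.bounded_linear_right)
  have "bounded_linear S"
  proof -
    obtain K where K: "\<And>a b. norm (B a b) \<le> norm a * norm b * K" and "K \<ge> 0"
      using B.nonneg_bounded by blast
    show ?thesis
    proof (rule bounded_linear_intro)
      fix x y and r :: real
      show "S (x + y) = S x + S y"
        by (rule blinfun_eqI) (simp add: S B.add_left blinfun.add_left)
      show "S (r *\<^sub>R x) = r *\<^sub>R S x"
        by (rule blinfun_eqI) (simp add: S B.scaleR_left blinfun.scaleR_left)
      show "norm (S x) \<le> norm x * K"
        using K[of x] \<open>K \<ge> 0\<close> by (intro norm_blinfun_bound) (simp_all add: S mult_ac)
    qed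
  qed
  fix \<xi> :: "'a bidual"
  \<comment> \<open>Boundedness makes the pullback of \<open>\<xi>\<close> a genuine element of the
    dual, so that \<open>Blinfun\<close> evaluates as expected.\<close>
  have bl: "bounded_linear (\<lambda>y. \<xi> (S y))"
    by (intro bounded_linear_compose[OF blinfun.bounded_linear_right] \<open>bounded_linear S\<close>)
  obtain x where x: "\<And>y. Blinfun (\<lambda>y. \<xi> (S y)) y = B x y"
    using riesz by blast
  have "\<xi> f = f x" for f
  proof -
    obtain y where "\<And>z. f z = B y z" using riesz by blast
    then have "f = S y" by (intro blinfun_eqI) (simp add: S)
    \<comment> \<open>Symmetry of \<open>B\<close> closes the chain: \<open>\<xi> f\<close> is
      \<open>\<xi> (S y)\<close>, hence \<open>B x y\<close>, hence \<open>B y x\<close>, which is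
      \<open>f x\<close>.\<close>
    then show ?thesis using x[of y] bl by (simp add: bounded_linear_Blinfun_apply S sym)
  qed
  then have "\<xi> = bidual_embed x" by (intro blinfun_eqI) simp
  then show "\<exists>x. \<xi> = bidual_embed x" ..
qed

theorem corollary3p18:
  fixes A :: "'a::banach \<Rightarrow> 'a dual" and \<delta> :: real
  assumes "linear A"
    and "continuous_on UNIV A"
    and "ultramaximally_monotone (gra A)"
    and "\<delta> > 0"
    and "\<And>x. blinfun_apply (A x) x \<ge> \<delta> * (norm x)\<^sup>2"
  shows "reflexive_space TYPE('a)"
proof (rule coercive_form_imp_reflexive)
  have A: "bounded_linear A"
    using assms(1,2) by (rule bounded_linear_if_linear_continuous)
  have bilinear: "bounded_bilinear (\<lambda>x y. A x y)"
    using A by (rule bounded_bilinear.comp1[OF bounded_bilinear_blinfun_apply])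
  \<comment> \<open>Adding the flipped form symmetrizes \<open>A\<close>; on the diagonal this gives
    \<open>2 * A x x\<close>, so coercivity survives with the same \<open>\<delta>\<close>.\<close>
  show "bounded_bilinear (\<lambda>x y. A x y + A y x)"
    using bounded_bilinear_add[OF bilinear bounded_bilinear.flip[OF bilinear]] .
  show "A x y + A y x = A y x + A x y" for x y by simp
  show "\<delta> > 0" by fact
  show "A x x + A x x \<ge> \<delta> * (norm x)\<^sup>2" for x
    using assms(5)[of x] \<open>\<delta> > 0\<close> by (smt (verit) mult_nonneg_nonneg zero_le_power2)
qed

end
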